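(* Let $\mathcal{P}_{\mathsf c}$ be the countable powerset functor on $\mathbf{Set}$. The set $\nu^{(\omega_1)}\mathcal{P}_{\mathsf c}$ has an element $a$, distinct from $0_{\omega_1}$, that has no successor; i.e. there is no $b\in\nu^{(\omega_1)}\mathcal{P}_{\mathsf c}$ with $b_j\in a_{j+1}$ for all $j<\omega_1$.
   Context: Work in ZFC. $\mathcal{P}_{\mathsf c}X$ is the set of countable (finite or countably infinite) subsets of $X$; it is a functor $\mathbf{Set}\to\mathbf{Set}$ via direct image. $0$ is deemed a limit ordinal. Final chain of an endofunctor $F$ on $\mathbf{Set}$: sets $\nu^{(i)}F$ for all ordinals $i$, with connecting maps $\nu^{(i\geqslant j)}F:\nu^{(i)}F\to\nu^{(j)}F$ for $j\leqslant i$ that are functorial (i.e. $\nu^{(i\geqslant i)}$ is the identity and $\nu^{(j\geqslant k)}\circ\nu^{(i\geqslant j)}=\nu^{(i\geqslant k)}$), determined by: $\nu^{(i+1)}F=F\nu^{(i)}F$ and $\nu^{(i+1\geqslant j+1)}=F\nu^{(i\geqslant j)}$; for $i$ a limit, $\nu^{(i)}F$ is the set of families $(x_j)_{j<i}$ with $x_j\in\nu^{(j)}F$ and $\nu^{(j\geqslant k)}x_j=x_k$ for $k\leqslant j<i$, and $\nu^{(i\geqslant j)}$ is the projection $x\mapsto x_j$ for $j<i$. In particular $\nu^{(0)}F=\{()\}$. The elements $0_i\in\nu^{(i)}\mathcal{P}_{\mathsf c}$ are: $0_{i+1}=\emptyset$, and $0_i=(0_j)_{j<i}$ for $i$ a limit.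 For a limit $i$ and $a,b\in\nu^{(i)}\mathcal{P}_{\mathsf c}$, $b$ is a successor of $a$ when $b_j\in a_{j+1}$ for all $j<i$. *)

theory Defs
  imports "HOL-Library.Countable_Set_Type"
begin

section \<open>Ordinals\<close>

text \<open>
  Ordinals are the elements of an arbitrary type \<^typ>\<open>'o::wellorder\<close>: the element \<open>i\<close> stands for the
  order type of \<open>{..<i}\<close>.
\<close>

text \<open>\<open>osuc i\<close> is \<open>i + 1\<close>; it is meaningful only if \<open>i\<close> is not the greatest element of the type.\<close>

definition osuc :: "'o::wellorder \<Rightarrow> 'o" where
  "osuc i = (LEAST k. i < k)"

definition is_limit :: "'o::wellorder \<Rightarrow> bool" where
  "is_limit i \<longleftrightarrow> \<not> (\<exists>j<i. i = osuc j)"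

definition opred :: "'o::wellorder \<Rightarrow> 'o" where
  "opred i = (THE j. j < i \<and> i = osuc j)"

definition is_omega1 :: "'o::wellorder \<Rightarrow> bool" where
  "is_omega1 w \<longleftrightarrow> uncountable {..<w} \<and> (\<forall>i<w. countable {..<i})"

lemma osuc_greater: "i < k \<Longrightarrow> i < osuc i"
  unfolding osuc_def by (rule LeastI)

lemma osuc_le: "i < k \<Longrightarrow> osuc i \<le> k"
  unfolding osuc_def by (rule Least_le)

lemma osuc_inj: "i < osuc i \<Longrightarrow> j < osuc j \<Longrightarrow> osuc i = osuc j \<Longrightarrow> i = j"
  by (metis antisym_conv3 leD osuc_le)

lemma opred_osuc: "i < osuc i \<Longrightarrow> opred (osuc i) = i"
  unfolding opred_def by (rule the_equality) (blast, metis osuc_inj)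

lemma not_limit_osuc: "i < osuc i \<Longrightarrow> \<not> is_limit (osuc i)"
  unfolding is_limit_def by blast

lemma not_limitE:
  assumes "\<not> is_limit i"
  obtains j where "j < i" "i = osuc j" "opred i = j"
  using assms opred_osuc unfolding is_limit_def by metis

lemma opred_less: "\<not> is_limit i \<Longrightarrow> opred i < i"
  by (metis not_limitE)

lemma is_limit_omega1:
  assumes "is_omega1 w"
  shows "is_limit w"
  unfolding is_limit_def
proof
  assume "\<exists>j<w. w = osuc j"
  then obtain j where j: "j < w" "w = osuc j" by blast
  have "{..<w} \<subseteq> insert j {..<j}"
  proof
    fix x assume "x \<in> {..<w}"
    then have "\<not> osuc j \<le> x" using j by auto
    then have "\<not> j < x" using osuc_le by blast
    then show "x \<in> insert j {..<j}" by auto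
  qed
  then show False
    using assms j(1) unfolding is_omega1_def by (metis countable_insert countable_subset)
qed

section \<open>The final chain of the countable powerset functor\<close>

text \<open>
  All the sets of the chain live in one type. Its elements are the countable sets of elements and the
  families of elements indexed by an initial segment \<open>{..<i}\<close>; such a family is encoded as a partial
  function with domain \<open>{..<i}\<close>.
\<close>

datatype 'o elt = CSet "'o elt cset" | Fam "'o \<Rightarrow> 'o elt option"

text \<open>\<open>component x j\<close> is the component \<open>x\<^sub>j\<close> of a family \<open>x\<close>.\<close>

fun component :: "'o elt \<Rightarrow> 'o \<Rightarrow> 'o elt" where
  "component (Fam f) j = the (f j)"
| "component (CSet A) j = undefined"

fun elts :: "'o elt \<Rightarrow> 'o elt set" where
  "elts (CSet A) = rcset A"
| "elts (Fam f) = {}"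

definition family :: "'o::wellorder \<Rightarrow> ('o \<Rightarrow> 'o elt) \<Rightarrow> 'o elt" where
  "family i g = Fam (\<lambda>j. if j < i then Some (g j) else None)"

definition Pc :: "'o elt set \<Rightarrow> 'o elt set" where
  "Pc X = {CSet A | A. rcset A \<subseteq> X}"

fun Pc_map :: "('o elt \<Rightarrow> 'o elt) \<Rightarrow> 'o elt \<Rightarrow> 'o elt" where
  "Pc_map f (CSet A) = CSet (cimage f A)"
| "Pc_map f (Fam g) = undefined"

text \<open>
  \<open>conn i j\<close> is the connecting map from stage \<open>i\<close> to stage \<open>j\<close>; only \<open>j \<le> i\<close> matters. If \<open>i\<close> is a
  successor and \<open>j < i\<close> is a limit, the map is forced by functoriality: for \<open>k < j\<close>, the component of
  the result at \<open>k\<close> is its image at stage \<open>k\<close>, which is the image of the argument at stage \<open>k\<close>.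
\<close>

function conn :: "'o::wellorder \<Rightarrow> 'o \<Rightarrow> 'o elt \<Rightarrow> 'o elt" where
  "conn i j =
     (if i \<le> j then id
      else if is_limit i then (\<lambda>x. component x j)
      else if is_limit j then (\<lambda>x. family j (\<lambda>k. if k < j then conn i k x else undefined))
      else Pc_map (conn (opred i) (opred j)))"
  by pat_completeness auto
termination
  by (relation "{(x, y). x < y} <*lex*> {(x, y). x < y}")
    (auto simp: wf opred_less)

declare conn.simps [simp del]

function nu :: "'o::wellorder \<Rightarrow> 'o elt set" where
  "nu i =
     (if is_limit i then
        {family i x | x.
           (\<forall>j. j < i \<longrightarrow> x j \<in> nu j) \<and> (\<forall>j<i. \<forall>k\<le>j. conn j k (x j) = x k)}
      else Pc (nu (opred i)))"
  by pat_completeness auto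
termination
  by (relation "{(x, y). x < y}") (auto simp: wf opred_less)

declare nu.simps [simp del]

function zero_elt :: "'o::wellorder \<Rightarrow> 'o elt" where
  "zero_elt i =
     (if is_limit i then family i (\<lambda>j. if j < i then zero_elt j else undefined) else CSet cempty)"
  by pat_completeness auto
termination
  by (relation "{(x, y). x < y}") (auto simp: wf)

declare zero_elt.simps [simp del]

text \<open>\<open>is_successor i a b\<close>: at the limit stage \<open>i\<close>, the element \<open>b\<close> is a successor of \<open>a\<close>.\<close>

definition is_successor :: "'o::wellorder \<Rightarrow> 'o elt \<Rightarrow> 'o elt \<Rightarrow> bool" where
  "is_successor i a b \<longleftrightarrow> (\<forall>j<i. component b j \<in> elts (component a (osuc j)))"

section \<open>The defining properties of the chain\<close>

lemma component_family [simp]: "j < i \<Longrightarrow> component (family i g) j = g j"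
  by (simp add: family_def)

lemma family_cong: "(\<And>j. j < i \<Longrightarrow> g j = h j) \<Longrightarrow> family i g = family i h"
  by (auto simp: family_def)

lemma family_eq_iff: "family i g = family i h \<longleftrightarrow> (\<forall>j<i. g j = h j)"
  by (metis component_family family_cong)

lemma nu_osuc: "i < osuc i \<Longrightarrow> nu (osuc i) = Pc (nu i)"
  by (subst nu.simps) (simp add: not_limit_osuc opred_osuc)

lemma nu_limit:
  "is_limit i \<Longrightarrow>
     nu i = {family i x | x. (\<forall>j<i. x j \<in> nu j) \<and> (\<forall>j<i. \<forall>k\<le>j. conn j k (x j) = x k)}"
  by (subst nu.simps) simp

lemma conn_refl: "conn i i = id"
  by (subst conn.simps) simp

lemma conn_osuc:
  assumes "j \<le> i" "i < osuc i" "x \<in> nu (osuc i)"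
  shows "conn (osuc i) (osuc j) x = Pc_map (conn i j) x"
proof (cases "j = i")
  case True
  then show ?thesis
    using assms by (auto simp: conn_refl nu_osuc Pc_def cset.map_id)
next
  case False
  then have "j < i" using assms by simp
  then have j: "j < osuc j" "osuc j < osuc i"
    using assms osuc_greater osuc_le by (blast, metis le_less_trans)
  then show ?thesis
    using assms by (subst conn.simps) (auto simp: not_limit_osuc opred_osuc dest: leD)
qed

lemma conn_from_limit: "is_limit i \<Longrightarrow> j < i \<Longrightarrow> conn i j x = component x j"
  by (subst conn.simps) (auto dest: leD)

lemma conn_to_limit:
  assumes "\<not> is_limit i" "is_limit j" "j < i"
  shows "conn i j x = family j (\<lambda>k. conn i k x)"
proof -
  have "conn i j x = family j (\<lambda>k. if k < j then conn i k x else undefined)"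
    using assms by (subst conn.simps) (auto dest: leD)
  also have "\<dots> = family j (\<lambda>k. conn i k x)"
    by (rule family_cong) simp
  finally show ?thesis .
qed

lemma conn_functorial:
  "j \<le> i \<Longrightarrow> x \<in> nu i \<Longrightarrow> conn i j x \<in> nu j \<and> (\<forall>k\<le>j. conn j k (conn i j x) = conn i k x)"
proof (induction i arbitrary: j x rule: less_induct)
  case outer: (less i)
  show ?case
  proof (cases "is_limit i")
    case True
    with outer.prems show ?thesis
      by (cases "j = i") (auto simp: conn_refl conn_from_limit nu_limit)
  next
    case False
    then obtain i' where i': "i' < i" "i = osuc i'" by (metis not_limitE)
    have nui: "nu i = Pc (nu i')" using i' nu_osuc by metis
    from \<open>j \<le> i\<close> show ?thesis
    proof (induction j rule: less_induct)
      case (less j)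
      show ?case
      proof (cases "j = i")
        case True
        then show ?thesis using outer.prems by (simp add: conn_refl)
      next
        case jni: False
        then have "j < i" using less.prems by simp
        show ?thesis
        proof (cases "is_limit j")
          case True
          have eq: "conn i j x = family j (\<lambda>k. conn i k x)"
            using conn_to_limit False True \<open>j < i\<close> by blast
          have IH: "k < j \<Longrightarrow>
              conn i k x \<in> nu k \<and> (\<forall>l\<le>k. conn k l (conn i k x) = conn i l x)" for k
            using less.IH[of k] \<open>j < i\<close> by (meson less_imp_le less_trans)
          have "conn i j x \<in> nu j"
            unfolding eq nu_limit[OF True] using IH by blast
          moreover have "conn j k (conn i j x) = conn i k x" if "k \<le> j" for k
            using that True by (cases "k = j") (simp_all add: conn_refl conn_from_limit eq)
          ultimately show ?thesis by blast
        next
          case jnl: False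
          then obtain j' where j': "j' < j" "j = osuc j'" by (metis not_limitE)
          have le: "j' \<le> i'"
            using j' i' \<open>j < i\<close> osuc_le[of i' j'] by (meson leI leD le_less_trans less_le_trans less_trans)
          have step: "conn i j x = Pc_map (conn i' j') x"
            using conn_osuc[of j' i' x] le i' j' outer.prems by simp
          have IH: "y \<in> nu i' \<Longrightarrow>
              conn i' j' y \<in> nu j' \<and> (\<forall>k\<le>j'. conn j' k (conn i' j' y) = conn i' k y)" for y
            using outer.IH[OF i'(1) le] .
          obtain A where A: "x = CSet A" "rcset A \<subseteq> nu i'"
            using outer.prems nui by (auto simp: Pc_def)
          have mem: "conn i j x \<in> nu j"
            using IH A nu_osuc[of j'] j' unfolding step by (auto simp: Pc_def cset.set_map)
          have "conn j k (conn i j x) = conn i k x" if "k \<le> j" for k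
            using that
          proof (induction k rule: less_induct)
            case inner: (less k)
            show ?case
            proof (cases "k = j")
              case True
              then show ?thesis by (simp add: conn_refl)
            next
              case kj: False
              then have "k < j" using inner.prems by simp
              show ?thesis
              proof (cases "is_limit k")
                case True
                have "family k (\<lambda>l. conn j l (conn i j x)) = family k (\<lambda>l. conn i l x)"
                  by (rule family_cong) (use inner.IH \<open>k < j\<close> in auto)
                then show ?thesis
                  using conn_to_limit[OF jnl True \<open>k < j\<close>]
                    conn_to_limit[OF False True] \<open>k < j\<close> \<open>j < i\<close> by auto
              next
                case False
                then obtain k' where k': "k' < k" "k = osuc k'" by (metis not_limitE)
                have le': "k' \<le> j'"
                  using j' k' \<open>k < j\<close> osuc_le[of j' k'] by (meson leI leD le_less_trans less_le_trans less_trans)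
                have 1: "conn j k (conn i j x) = Pc_map (conn j' k') (conn i j x)"
                  using conn_osuc[of k' j' "conn i j x"] le' j' k' mem by simp
                have 2: "conn i k x = Pc_map (conn i' k') x"
                  using conn_osuc[of k' i' x] le le' i' k' outer.prems by simp
                have 3: "cimage (\<lambda>y. conn j' k' (conn i' j' y)) A = cimage (conn i' k') A"
                  by (rule cset.map_cong0) (use IH A(2) le' in auto)
                have "conn j k (conn i j x) = CSet (cimage (\<lambda>y. conn j' k' (conn i' j' y)) A)"
                  by (simp only: 1) (simp add: A(1) step[unfolded A(1)] cset.map_comp comp_def)
                with 3 show ?thesis unfolding 2 by (simp add: A(1))
              qed
            qed
          qed
          with mem show ?thesis by blast
        qed
      qed
    qed
  qed
qed

lemma zero_elt_osuc: "i < osuc i \<Longrightarrow> zero_elt (osuc i) = CSet cempty"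
  by (subst zero_elt.simps) (simp add: not_limit_osuc)

lemma zero_elt_limit: "is_limit i \<Longrightarrow> zero_elt i = family i zero_elt"
  by (subst zero_elt.simps) (auto intro: family_cong)

section \<open>A type of ordinals containing \<open>\<omega>\<^sub>1\<close>\<close>

typedef ord1 = "insert None (Some ` Field (cardSuc natLeq))"
  by blast

setup_lifting type_definition_ord1

lemma cardSuc_natLeq_facts:
  "refl_on (Field (cardSuc natLeq)) (cardSuc natLeq)" "trans (cardSuc natLeq)"
  "antisym (cardSuc natLeq)" "total_on (Field (cardSuc natLeq)) (cardSuc natLeq)"
  "wf (cardSuc natLeq - Id)"
  using cardSuc_Well_order[OF natLeq_Card_order]
  by (auto simp: well_order_on_def linear_order_on_def partial_order_on_def preorder_on_def)

instantiation ord1 :: linorder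
begin

lift_definition less_eq_ord1 :: "ord1 \<Rightarrow> ord1 \<Rightarrow> bool" is
  "\<lambda>x y. y = None \<or> (\<exists>a b. x = Some a \<and> y = Some b \<and> (a, b) \<in> cardSuc natLeq)" .

definition less_ord1 :: "ord1 \<Rightarrow> ord1 \<Rightarrow> bool" where
  "less_ord1 x y \<longleftrightarrow> x \<le> y \<and> \<not> y \<le> x"

instance
proof
  fix x y z :: ord1
  show "x < y \<longleftrightarrow> x \<le> y \<and> \<not> y \<le> x" by (rule less_ord1_def)
  have in_Field: "a \<in> Field (cardSuc natLeq)" if "Rep_ord1 u = Some a" for u :: ord1 and a
    using Rep_ord1[of u] that by auto
  show "x \<le> x"
  proof (cases "Rep_ord1 x")
    case (Some a)
    then have "(a, a) \<in> cardSuc natLeq"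
      using refl_onD[OF cardSuc_natLeq_facts(1)] in_Field by blast
    with Some show ?thesis unfolding less_eq_ord1.rep_eq by blast
  qed (simp add: less_eq_ord1.rep_eq)
  show "x \<le> z" if "x \<le> y" "y \<le> z"
  proof (cases "Rep_ord1 z")
    case (Some c)
    with that obtain a b where "Rep_ord1 x = Some a" "(a, b) \<in> cardSuc natLeq" "(b, c) \<in> cardSuc natLeq"
      unfolding less_eq_ord1.rep_eq by force
    then show ?thesis
      using Some transD[OF cardSuc_natLeq_facts(2)] unfolding less_eq_ord1.rep_eq by blast
  qed (simp add: less_eq_ord1.rep_eq)
  show "x = y" if "x \<le> y" "y \<le> x"
  proof -
    have "Rep_ord1 x = Rep_ord1 y"
    proof (cases "Rep_ord1 x")
      case None
      with that(1) show ?thesis unfolding less_eq_ord1.rep_eq by simp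
    next
      case (Some a)
      with that obtain b where b: "Rep_ord1 y = Some b" "(a, b) \<in> cardSuc natLeq" "(b, a) \<in> cardSuc natLeq"
        unfolding less_eq_ord1.rep_eq by force
      then have "a = b" using antisymD[OF cardSuc_natLeq_facts(3)] by blast
      with Some b show ?thesis by simp
    qed
    then show ?thesis by (simp add: Rep_ord1_inject)
  qed
  show "x \<le> y \<or> y \<le> x"
  proof (cases "Rep_ord1 x = None \<or> Rep_ord1 y = None")
    case True
    then show ?thesis unfolding less_eq_ord1.rep_eq by blast
  next
    case False
    then obtain a b where ab: "Rep_ord1 x = Some a" "Rep_ord1 y = Some b" by auto
    then have "(a, b) \<in> cardSuc natLeq \<or> (b, a) \<in> cardSuc natLeq"
      using in_Field cardSuc_natLeq_facts(1,4) refl_onD unfolding total_on_def by metis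
    with ab show ?thesis unfolding less_eq_ord1.rep_eq by blast
  qed
qed

end

lift_definition omega1 :: ord1 is None
  by blast

lemma le_omega1: "x \<le> omega1"
  by transfer simp

lemma less_omega1E:
  assumes "x < omega1"
  obtains a where "a \<in> Field (cardSuc natLeq)" "x = Abs_ord1 (Some a)"
proof -
  have "Rep_ord1 x \<noteq> None"
    using assms by (metis less_irrefl omega1.rep_eq Rep_ord1_inject)
  then obtain a where a: "a \<in> Field (cardSuc natLeq)" "Rep_ord1 x = Some a"
    using Rep_ord1[of x] by auto
  have "x = Abs_ord1 (Some a)" using a(2) Rep_ord1_inverse[of x] by simp
  with a(1) show ?thesis by (rule that)
qed

lemma less_ord1_Some:
  assumes "x < y" "y = Abs_ord1 (Some b)" "b \<in> Field (cardSuc natLeq)"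
  obtains a where "x = Abs_ord1 (Some a)" "(a, b) \<in> cardSuc natLeq - Id"
proof -
  have y: "Rep_ord1 y = Some b"
    unfolding assms(2) by (rule Abs_ord1_inverse) (use assms(3) in blast)
  obtain a where a: "Rep_ord1 x = Some a" "(a, b) \<in> cardSuc natLeq"
    using assms(1) y unfolding less_ord1_def less_eq_ord1.rep_eq by auto
  have "x \<noteq> y" using assms(1) by blast
  then have "a \<noteq> b" using a(1) y Rep_ord1_inject[of x y] by auto
  with a(2) have ab: "(a, b) \<in> cardSuc natLeq - Id" by simp
  have "x = Abs_ord1 (Some a)" using a(1) Rep_ord1_inverse[of x] by simp
  then show ?thesis using ab by (rule that)
qed

instance ord1 :: wellorder
proof (rule wf_wellorderI)
  have ind: "P (Abs_ord1 (Some b))"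
    if step: "\<And>x::ord1. (\<And>y. y < x \<Longrightarrow> P y) \<Longrightarrow> P x"
      and "b \<in> Field (cardSuc natLeq)" for P b
    using that(2)
  proof (induction b rule: wf_induct_rule[OF cardSuc_natLeq_facts(5)])
    case (1 b)
    show ?case
    proof (rule step)
      fix y assume "y < Abs_ord1 (Some b)"
      then obtain a where "y = Abs_ord1 (Some a)" "(a, b) \<in> cardSuc natLeq - Id"
        using less_ord1_Some[OF _ refl 1(2)] by blast
      then show "P y" using 1(1)[of a] by (auto simp: Field_def)
    qed
  qed
  show "wf {(x::ord1, y). x < y}"
  proof (rule wfUNIVI)
    fix P and x :: ord1
    assume "\<forall>x::ord1. (\<forall>y. (y, x) \<in> {(x, y). x < y} \<longrightarrow> P y) \<longrightarrow> P x"
    then have step: "\<And>x. (\<And>y. y < x \<Longrightarrow> P y) \<Longrightarrow> P x" by blast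
    have "P y" if "y < omega1" for y
      using that by (rule less_omega1E) (use ind[of P, OF step] in auto)
    then show "P x"
      using step[of omega1] le_omega1[of x] by (auto simp: order_le_less)
  qed
qed standard

theorem is_omega1_omega1: "is_omega1 omega1"
  unfolding is_omega1_def
proof
  include cardinal_syntax
  let ?r = "cardSuc natLeq"
  have r: "Card_order ?r" by (rule cardSuc_Card_order[OF natLeq_Card_order])
  have unc: "uncountable (Field ?r)"
  proof
    assume "countable (Field ?r)"
    then have "|Field ?r| \<le>o natLeq" by (simp add: countable_card_le_natLeq)
    then have "?r \<le>o natLeq"
      using card_of_Field_ordIso[OF r] ordIso_ordLeq_trans ordIso_symmetric by blast
    then show False
      using cardSuc_greater[OF natLeq_Card_order] not_ordLess_ordLeq by blast
  qed
  have "(\<lambda>a. Abs_ord1 (Some a)) ` Field ?r \<subseteq> {..< omega1}"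
  proof clarify
    fix a assume "a \<in> Field ?r"
    then have "Abs_ord1 (Some a) \<noteq> omega1"
      by (metis Abs_ord1_inverse image_eqI insertCI omega1.rep_eq option.distinct(1))
    then show "Abs_ord1 (Some a) < omega1" using le_omega1 order_le_less by blast
  qed
  moreover have "inj_on (\<lambda>a. Abs_ord1 (Some a)) (Field ?r)"
    by (auto simp: inj_on_def Abs_ord1_inject)
  ultimately show "uncountable {..< omega1}"
    using unc by (metis countable_image_inj_on countable_subset)
  show "\<forall>i < omega1. countable {..<i}"
  proof (intro allI impI)
    fix i assume "i < omega1"
    then obtain b where b: "b \<in> Field ?r" "i = Abs_ord1 (Some b)" by (rule less_omega1E)
    have "|underS ?r b| <o ?r" using card_of_underS[OF r b(1)] .
    then have "countable (underS ?r b)"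
      unfolding countable_card_le_natLeq
      using cardSuc_ordLeq_ordLess[OF natLeq_Card_order card_of_Card_order] by blast
    moreover have "{..<i} \<subseteq> (\<lambda>a. Abs_ord1 (Some a)) ` underS ?r b"
    proof
      fix x assume "x \<in> {..<i}"
      then obtain a where "x = Abs_ord1 (Some a)" "(a, b) \<in> ?r - Id"
        using less_ord1_Some[OF _ b(2,1)] by blast
      then show "x \<in> (\<lambda>a. Abs_ord1 (Some a)) ` underS ?r b"
        by (auto simp: underS_def)
    qed
    ultimately show "countable {..<i}"
      by (rule countable_subset[rotated, OF countable_image])
  qed
qed

end

theory Submission
  imports Defs
begin

text \<open>
  There are finite-to-one functions \<open>e\<^sub>i : i \<rightarrow> \<omega>\<close> for \<open>i < \<omega>\<^sub>1\<close> such that \<open>e\<^sub>i\<close> restricted to \<open>j < i\<close> differs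
  from \<open>e\<^sub>j\<close> at finitely many places only. The finite modifications \<open>T\<^sub>i\<close> of \<open>e\<^sub>i\<close> form the levels of an
  Aronszajn tree: the levels are countable, every node extends to every higher level, and there is no
  branch of length \<open>\<omega>\<^sub>1\<close>, since it would be a finite-to-one function \<open>\<omega>\<^sub>1 \<rightarrow> \<omega>\<close>. Coding the graph of
  a node \<open>f\<close> by a set of ordinals, and the ordinals by the corresponding elements of the final chain,
  we embed the tree into the chain. The element \<open>a\<close> whose component at \<open>i + 1\<close> is the image of \<open>T\<^sub>i\<close>
  is then well defined, and a successor of \<open>a\<close> would be a branch of length \<open>\<omega>\<^sub>1\<close>.
\<close>

section \<open>Coherent finite-to-one functions\<close>

lemma from_nat_into_lessThan: "k < i \<Longrightarrow> from_nat_into {..<i} n < i" for i :: "'o::wellorder"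
  using from_nat_into[of "{..<i}" n] by auto

text \<open>
  With \<open>g\<close> an enumeration of \<open>{..<i}\<close> and \<open>n\<close> least such that \<open>k \<le> g n\<close>, the value at \<open>k\<close> is copied
  from stage \<open>g n\<close>. The maximum with \<open>n\<close> keeps the fibres finite; the result is coherent with stage
  \<open>g m\<close> because only \<open>n \<le> m\<close> occur for \<open>k \<le> g m\<close>.
\<close>

function coh :: "'o::wellorder \<Rightarrow> 'o \<Rightarrow> nat" where
  "coh i k =
     (if k < i then
        let n = (LEAST n. k \<le> from_nat_into {..<i} n)
        in max n (coh (from_nat_into {..<i} n) k)
      else 0)"
  by pat_completeness auto
termination
  by (relation "inv_image {(x, y). x < y} fst")
    (auto simp: wf intro: from_nat_into_lessThan)

declare coh.simps [simp del]

lemma coh_ge [simp]: "i \<le> k \<Longrightarrow> coh i k = 0"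
  by (subst coh.simps) simp

lemma coh_less:
  assumes "countable {..<i}" "k < i"
  obtains n where "k \<le> from_nat_into {..<i} n" "\<And>m. k \<le> from_nat_into {..<i} m \<Longrightarrow> n \<le> m"
    "coh i k = max n (coh (from_nat_into {..<i} n) k)"
proof -
  define n where "n = (LEAST n. k \<le> from_nat_into {..<i} n)"
  obtain m where "from_nat_into {..<i} m = k"
    using from_nat_into_surj[OF assms(1)] assms(2) by blast
  then have "k \<le> from_nat_into {..<i} n"
    unfolding n_def using LeastI[of "\<lambda>n. k \<le> from_nat_into {..<i} n" m] by simp
  moreover have "n \<le> m" if "k \<le> from_nat_into {..<i} m" for m
    unfolding n_def using that by (rule Least_le)
  moreover have "coh i k = max n (coh (from_nat_into {..<i} n) k)"
    using assms(2) by (simp add: coh.simps[of i k] n_def Let_def)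
  ultimately show ?thesis by (rule that)
qed

text \<open>The value at \<open>k\<close> is at least the index chosen for \<open>k\<close>, so
  values up to \<open>n\<close> come only from stages enumerated up to index \<open>n\<close>;
  induction handles each.\<close>

lemma finite_coh_le:
  assumes "\<And>j. j \<le> i \<Longrightarrow> countable {..<j}"
  shows "finite {k. k < i \<and> coh i k \<le> n}"
  using assms
proof (induction i rule: less_induct)
  case (less i)
  let ?g = "from_nat_into {..<i}"
  show ?case
  proof (cases "{..<i} = {}")
    case False
    then have g: "?g m < i" for m using from_nat_into[of "{..<i}" m] by simp
    \<comment> \<open>The point \<open>?g m\<close> is added by hand: the induction hypothesis
      covers only \<open>k < ?g m\<close>.\<close>
    have sub: "{k. k < i \<and> coh i k \<le> n} \<subseteq> (\<Union>m\<le>n. insert (?g m) {k. k < ?g m \<and> coh (?g m) k \<le> n})"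
    proof clarify
      fix k assume k: "k < i" "coh i k \<le> n"
      obtain m where m: "k \<le> ?g m" "coh i k = max m (coh (?g m) k)"
        using coh_less[OF less.prems[OF order_refl] k(1)] by metis
      then show "k \<in> (\<Union>m\<le>n. insert (?g m) {k. k < ?g m \<and> coh (?g m) k \<le> n})"
        using k(2) by (intro UN_I[of m]) auto
    qed
    have "finite {k. k < ?g m \<and> coh (?g m) k \<le> n}" for m
      using g less.prems by (intro less.IH) (meson less_imp_le order_trans)+
    then show ?thesis by (intro finite_subset[OF sub]) simp
  next
    case True
    then have "\<not> k < i" for k by blast
    then show ?thesis by simp
  qed
qed

lemma finite_coh_diff:
  assumes "\<And>j. j \<le> i \<Longrightarrow> countable {..<j}" "j \<le> i"
  shows "finite {k. k < j \<and> coh i k \<noteq> coh j k}"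
  using assms
proof (induction i arbitrary: j rule: less_induct)
  case (less i)
  let ?g = "from_nat_into {..<i}"
  show ?case
  proof (cases "j = i")
    case False
    then have "j < i" using less.prems by simp
    then have g: "?g m < i" for m using from_nat_into[of "{..<i}" m] by auto
    obtain m where m: "?g m = j"
      using from_nat_into_surj[OF less.prems(1)[OF order_refl]] \<open>j < i\<close> by blast
    \<comment> \<open>For \<open>k\<close> with index \<open>n\<close>, \<open>coh i k\<close>
      equals \<open>coh (?g n) k\<close> unless the latter is at most \<open>n\<close>. Stages
      \<open>?g n\<close> and \<open>j\<close> lie below \<open>i\<close> in either order, hence
      \<open>min\<close> and \<open>max\<close>.\<close>
    let ?D = "\<lambda>n. insert (?g n) ({k. k < ?g n \<and> coh (?g n) k \<le> n}
      \<union> {k. k < min (?g n) j \<and> coh (max (?g n) j) k \<noteq> coh (min (?g n) j) k})"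
    have sub: "{k. k < j \<and> coh i k \<noteq> coh j k} \<subseteq> (\<Union>n\<le>m. ?D n)"
    proof clarify
      fix k assume k: "k < j" "coh i k \<noteq> coh j k"
      obtain n where n: "k \<le> ?g n" "k \<le> ?g m \<Longrightarrow> n \<le> m" "coh i k = max n (coh (?g n) k)"
        using coh_less[OF less.prems(1)[OF order_refl], of k] k(1) \<open>j < i\<close> by (metis less_trans)
      have "k \<in> ?D n"
      proof (cases "k = ?g n \<or> coh (?g n) k \<le> n")
        case False
        then have "coh i k = coh (?g n) k" "k < ?g n" using n by auto
        then show ?thesis using k by (cases "?g n \<le> j") auto
      qed (use n(1) in auto)
      moreover have "n \<le> m" using n(2) m k(1) by simp
      ultimately show "k \<in> (\<Union>n\<le>m. ?D n)" by blast
    qed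
    have "finite (?D n)" for n
    proof -
      have "finite {k. k < ?g n \<and> coh (?g n) k \<le> n}"
        using g less.prems by (intro finite_coh_le) (meson less_imp_le order_trans)
      moreover have "finite {k. k < min (?g n) j \<and> coh (max (?g n) j) k \<noteq> coh (min (?g n) j) k}"
      proof (rule less.IH)
        show less: "max (?g n) j < i" using g[of n] \<open>j < i\<close> by simp
        show "countable {..<l}" if "l \<le> max (?g n) j" for l
          using less.prems(1) less_imp_le[OF le_less_trans[OF that less]] .
        show "min (?g n) j \<le> max (?g n) j" by (simp add: min.coboundedI2)
      qed
      ultimately show ?thesis by simp
    qed
    then show ?thesis by (intro finite_subset[OF sub]) simp
  qed simp
qed

section \<open>Levels of the Aronszajn tree\<close>

definition coh_tree :: "'o::wellorder \<Rightarrow> ('o \<Rightarrow> nat) set" where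
  "coh_tree i = {f. finite {k. f k \<noteq> coh i k} \<and> (\<forall>k\<ge>i. f k = 0)}"

lemma coh_in_coh_tree: "coh i \<in> coh_tree i"
  by (simp add: coh_tree_def)

text \<open>A node is \<open>coh i\<close> overwritten along a finite graph \<open>A\<close>, which
  is what \<open>F A\<close> does, and there are countably many such graphs.\<close>

lemma countable_coh_tree:
  assumes "countable {..<i}"
  shows "countable (coh_tree i)"
proof -
  define F where "F A k = (if \<exists>n. (k, n) \<in> A then THE n. (k, n) \<in> A else coh i k)" for A k
  let ?P = "{A. finite A \<and> A \<subseteq> {..<i} \<times> (UNIV :: nat set)}"
  have "coh_tree i \<subseteq> F ` ?P"
  proof
    fix f assume f: "f \<in> coh_tree i"
    let ?A = "(\<lambda>k. (k, f k)) ` {k. f k \<noteq> coh i k}"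
    have "f = F ?A"
    proof
      fix k
      have "(k, n) \<in> ?A \<longleftrightarrow> f k \<noteq> coh i k \<and> n = f k" for n by auto
      then show "f k = F ?A k" by (simp add: F_def)
    qed
    moreover have "k < i" if "f k \<noteq> coh i k" for k
      using that f by (cases "k < i") (simp_all add: coh_tree_def)
    then have "?A \<in> ?P" using f by (auto simp: coh_tree_def)
    ultimately show "f \<in> F ` ?P" by blast
  qed
  moreover have "countable (F ` ?P)"
    using assms by (intro countable_image countable_Collect_finite_subset countable_SIGMA) simp_all
  ultimately show ?thesis by (rule countable_subset)
qed

text \<open>Together with \<open>coh_tree_extend\<close>, this makes restriction a surjection
  between levels; coherence keeps the changed places finite.\<close>

lemma coh_tree_restrict:
  assumes "\<And>j. j \<le> i \<Longrightarrow> countable {..<j}" "j \<le> i" "f \<in> coh_tree i"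
  shows "(\<lambda>k. if k < j then f k else 0) \<in> coh_tree j"
proof -
  have "finite ({k. f k \<noteq> coh i k} \<union> {k. k < j \<and> coh i k \<noteq> coh j k})"
    using finite_coh_diff[OF assms(1,2)] assms(3) by (simp add: coh_tree_def)
  then have "finite {k. (if k < j then f k else 0) \<noteq> coh j k}"
    by (rule rev_finite_subset) (auto split: if_splits)
  then show ?thesis by (auto simp: coh_tree_def)
qed

lemma coh_tree_extend:
  assumes "\<And>j. j \<le> i \<Longrightarrow> countable {..<j}" "j \<le> i" "f \<in> coh_tree j"
  shows "(\<lambda>k. if k < j then f k else coh i k) \<in> coh_tree i"
proof -
  have "finite ({k. f k \<noteq> coh j k} \<union> {k. k < j \<and> coh i k \<noteq> coh j k})"
    using finite_coh_diff[OF assms(1,2)] assms(3) by (simp add: coh_tree_def)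
  then have "finite {k. (if k < j then f k else coh i k) \<noteq> coh i k}"
    by (rule rev_finite_subset) (auto split: if_splits)
  then show ?thesis using assms(2) by (auto simp: coh_tree_def not_less)
qed

lemma coh_tree_finite_fibre:
  assumes "\<And>j. j \<le> i \<Longrightarrow> countable {..<j}" "f \<in> coh_tree i"
  shows "finite {k. k < i \<and> f k = n}"
proof -
  have "finite ({k. f k \<noteq> coh i k} \<union> {k. k < i \<and> coh i k \<le> n})"
    using finite_coh_le[OF assms(1)] assms(2) by (simp add: coh_tree_def)
  then show ?thesis by (rule rev_finite_subset) auto
qed

section \<open>Unfolding stage-dependent coalgebras\<close>

text \<open>\<open>E c j\<close> holds the successors of state \<open>c\<close> as seen from stage
  \<open>j\<close>, so a state may have a different countable successor set at each stage.\<close>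

function unfold :: "('a \<Rightarrow> 'o \<Rightarrow> 'a set) \<Rightarrow> 'a \<Rightarrow> 'o::wellorder \<Rightarrow> 'o elt" where
  "unfold E c i =
     (if is_limit i then family i (\<lambda>j. if j < i then unfold E c j else undefined)
      else CSet (acset ((\<lambda>d. unfold E d (opred i)) ` E c (opred i))))"
  by pat_completeness auto
termination
  by (relation "inv_image {(x, y). x < y} (\<lambda>(E, c, i). i)")
    (auto simp: wf opred_less)

declare unfold.simps [simp del]

lemma unfold_limit: "is_limit i \<Longrightarrow> unfold E c i = family i (unfold E c)"
  by (subst unfold.simps) (auto intro: family_cong)

lemma unfold_osuc: "i < osuc i \<Longrightarrow> unfold E c (osuc i) = CSet (acset ((\<lambda>d. unfold E d i) ` E c i))"
  by (subst unfold.simps) (simp add: not_limit_osuc opred_osuc)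

lemma elts_unfold_osuc:
  "i < osuc i \<Longrightarrow> countable (E c i) \<Longrightarrow> elts (unfold E c (osuc i)) = (\<lambda>d. unfold E d i) ` E c i"
  by (simp add: unfold_osuc acset_inverse)

text \<open>Between successor stages connecting maps are direct images, so it is enough that
  \<open>E c i\<close> and \<open>E c j\<close> have the same values at stage
  \<open>j\<close>.\<close>

lemma unfold_thread:
  assumes count: "\<And>c i. c \<in> K \<Longrightarrow> i < w \<Longrightarrow> countable (E c i)"
    and closed: "\<And>c i. c \<in> K \<Longrightarrow> i < w \<Longrightarrow> E c i \<subseteq> K"
    and coherent: "\<And>c i j. c \<in> K \<Longrightarrow> j \<le> i \<Longrightarrow> i < w \<Longrightarrow>
      (\<lambda>d. unfold E d j) ` E c i = (\<lambda>d. unfold E d j) ` E c j"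
    and "i \<le> w" "c \<in> K"
  shows "unfold E c i \<in> nu i \<and> (\<forall>k\<le>i. conn i k (unfold E c i) = unfold E c k)"
  using assms(4,5)
proof (induction i arbitrary: c rule: less_induct)
  case (less i)
  show ?case
  proof (cases "is_limit i")
    case True
    have IH: "unfold E c j \<in> nu j \<and> (\<forall>k\<le>j. conn j k (unfold E c j) = unfold E c k)" if "j < i" for j
      using less.IH[OF that] less.prems that by auto
    have "unfold E c i \<in> nu i"
      unfolding nu_limit[OF True] unfold_limit[OF True] using IH by blast
    moreover have "conn i k (unfold E c i) = unfold E c k" if "k \<le> i" for k
      using that by (cases "k = i") (simp_all add: conn_refl conn_from_limit True unfold_limit[OF True])
    ultimately show ?thesis by blast
  next
    case False
    then obtain i' where i': "i' < i" "i = osuc i'" by (metis not_limitE)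
    then have iw: "i' < w" using less.prems by simp
    let ?x = "unfold E c i"
    have x: "?x = CSet (acset ((\<lambda>d. unfold E d i') ` E c i'))"
      using i' unfold_osuc by metis
    have cnt: "countable ((\<lambda>d. unfold E d k) ` E c i')" for k
      using count[OF less.prems(2) iw] by simp
    have IH: "unfold E d i' \<in> nu i' \<and> (\<forall>k\<le>i'. conn i' k (unfold E d i') = unfold E d k)"
      if "d \<in> E c i'" for d
      using less.IH[OF i'(1)] iw that closed[OF less.prems(2) iw] by auto
    have mem: "?x \<in> nu i"
    proof -
      have "?x \<in> Pc (nu i')" using IH cnt by (auto simp: x Pc_def acset_inverse)
      then show ?thesis using i' nu_osuc by metis
    qed
    \<comment> \<open>A connecting map into a limit is built from those to lower stages, hence the
      inner induction on \<open>k\<close>.\<close>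
    have "conn i k ?x = unfold E c k" if "k \<le> i" for k
      using that
    proof (induction k rule: less_induct)
      case inner: (less k)
      show ?case
      proof (cases "k = i")
        case True
        then show ?thesis by (simp add: conn_refl)
      next
        case ki: False
        then have "k < i" using inner.prems by simp
        show ?thesis
        proof (cases "is_limit k")
          case True
          have "conn i k ?x = family k (\<lambda>l. conn i l ?x)"
            using conn_to_limit[OF False True \<open>k < i\<close>] .
          also have "\<dots> = family k (unfold E c)"
            by (rule family_cong) (use inner.IH \<open>k < i\<close> in auto)
          finally show ?thesis by (simp add: unfold_limit[OF True])
        next
          case False
          then obtain k' where k': "k' < k" "k = osuc k'" by (metis not_limitE)
          have le: "k' \<le> i'"
            using i' k' \<open>k < i\<close> osuc_le[of i' k'] by (meson leI leD le_less_trans less_le_trans less_trans)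
          have "conn i k ?x = Pc_map (conn i' k') ?x"
            using conn_osuc[of k' i' ?x] le i' k' mem by simp
          also have "\<dots> = CSet (cimage (conn i' k') (acset ((\<lambda>d. unfold E d i') ` E c i')))"
            by (simp add: x)
          also have "cimage (conn i' k') (acset ((\<lambda>d. unfold E d i') ` E c i'))
              = acset ((\<lambda>d. unfold E d k') ` E c k')"
          proof -
            have "rcset (cimage (conn i' k') (acset ((\<lambda>d. unfold E d i') ` E c i')))
                = (\<lambda>d. unfold E d k') ` E c i'"
              using IH le cnt by (auto simp: cset.set_map acset_inverse image_image)
            then show ?thesis
              using coherent[OF less.prems(2) le iw] by (metis rcset_inverse)
          qed
          finally show ?thesis using k' unfold_osuc by metis
        qed
      qed
    qed
    with mem show ?thesis by blast
  qed
qed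

section \<open>Countable ordinals\<close>

lemma omega1_osuc:
  assumes "is_omega1 w" "i < w"
  shows "i < osuc i" "osuc i < w"
  using assms is_limit_omega1[OF assms(1)] osuc_greater osuc_le
  unfolding is_limit_def by (blast, metis order_le_less)

text \<open>Regularity: otherwise \<open>w\<close> would be a countable union of countable initial
  segments.\<close>

lemma omega1_bounded:
  assumes "is_omega1 w" "countable A" "\<And>x. x \<in> A \<Longrightarrow> g x < w"
  shows "\<exists>j<w. \<forall>x\<in>A. g x < j"
proof (rule ccontr)
  assume "\<not> ?thesis"
  then have *: "\<exists>x\<in>A. j \<le> g x" if "j < w" for j
    using that by (meson not_less)
  have "{..<w} \<subseteq> (\<Union>x\<in>A. {..<osuc (g x)})"
  proof
    fix j assume "j \<in> {..<w}"
    with * obtain x where x: "x \<in> A" "j \<le> g x" by blast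
    then show "j \<in> (\<Union>x\<in>A. {..<osuc (g x)})"
      using omega1_osuc(1)[OF assms(1) assms(3)] by (blast intro: le_less_trans)
  qed
  moreover have "countable (\<Union>x\<in>A. {..<osuc (g x)})"
    using assms omega1_osuc(2)[OF assms(1)] unfolding is_omega1_def by blast
  ultimately show False
    using assms(1) countable_subset unfolding is_omega1_def by blast
qed

text \<open>Forgetting the second coordinate of a bijection from triples gives each pair uncountably
  many codes, of which only countably many lie below \<open>i\<close>.\<close>

lemma omega1_coding:
  fixes w :: "'o::wellorder"
  assumes "is_omega1 w"
  obtains c :: "'o \<Rightarrow> 'o \<times> nat" where "\<And>i n. i < w \<Longrightarrow> \<exists>k. i \<le> k \<and> k < w \<and> c k = (i, n)"
proof -
  include cardinal_syntax
  let ?W = "{..<w}"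
  have unc: "uncountable ?W" using assms by (simp add: is_omega1_def)
  then have inf: "infinite ?W" using countable_finite by blast
  have "|UNIV :: nat set| \<le>o |?W|" using inf infinite_iff_card_of_nat by blast
  moreover have WW: "|?W \<times> ?W| =o |?W|" by (rule card_of_Times_same_infinite[OF inf])
  ultimately have "|(?W \<times> ?W) \<times> (UNIV :: nat set)| =o |?W|"
    using card_of_Times_infinite_simps(1)[of "?W \<times> ?W" "UNIV :: nat set"] inf
    by (metis card_of_ordIso_finite ordIso_symmetric ordIso_transitive ordLeq_ordIso_trans UNIV_not_empty)
  then obtain h where h: "bij_betw h ((?W \<times> ?W) \<times> (UNIV :: nat set)) ?W"
    unfolding card_of_ordIso[symmetric] by blast
  define c where "c k = (let p = inv_into ((?W \<times> ?W) \<times> UNIV) h k in (fst (fst p), snd p))" for k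
  have c: "c (h ((i, j), n)) = (i, n)" if "i < w" "j < w" for i j n
    using that h unfolding c_def by (simp add: bij_betw_inv_into_left Let_def)
  show ?thesis
  proof (rule that)
    fix i n assume i: "i < w"
    let ?H = "(\<lambda>j. h ((i, j), n)) ` ?W"
    have "inj_on (\<lambda>j. h ((i, j), n)) ?W"
      using i bij_betw_imp_inj_on[OF h] by (auto simp: inj_on_def)
    then have "uncountable ?H" using unc countable_image_inj_on by blast
    moreover have "countable {..<i}" using assms i by (simp add: is_omega1_def)
    ultimately obtain j where j: "j < w" "\<not> h ((i, j), n) < i"
      using countable_subset[of ?H "{..<i}"] by auto
    moreover have "h ((i, j), n) < w"
      using bij_betw_apply[OF h, of "((i, j), n)"] i j(1) by simp
    ultimately show "\<exists>k. i \<le> k \<and> k < w \<and> c k = (i, n)"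
      using c i by (intro exI[of _ "h ((i, j), n)"]) auto
  qed
qed

section \<open>The tree inside the final chain\<close>

text \<open>Up to truncation at each stage, \<open>Ord k\<close> stands for the von Neumann ordinal
  \<open>k\<close>, \<open>Seq f\<close> for the coded graph of \<open>f\<close>, and
  \<open>Root\<close> for \<open>a\<close>.\<close>

datatype 'o node = Ord 'o | Seq "'o \<Rightarrow> nat" | Root

locale omega1_coding =
  fixes w :: "'o::wellorder" and c :: "'o \<Rightarrow> 'o \<times> nat" \<comment> \<open>the ordinal \<open>k\<close> codes the pair \<open>c k\<close>\<close>
  assumes omega1: "is_omega1 w"
    and coding: "i < w \<Longrightarrow> \<exists>k. i \<le> k \<and> k < w \<and> c k = (i, n)"
begin

text \<open>
  At stage \<open>i\<close> all ordinals \<open>k \<ge> i\<close> are identified with \<open>i\<close>. Adding \<open>Ord i\<close> to the edges of \<open>Seq f\<close>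
  therefore hides which ordinals beyond \<open>i\<close> occur. The guard \<open>fst (c k) \<le> k\<close> ensures that only \<open>f\<close>
  restricted to \<open>i\<close> matters.
\<close>

fun edges :: "'o node \<Rightarrow> 'o \<Rightarrow> 'o node set" where
  "edges (Ord k) i = Ord ` {..<k}"
| "edges (Seq f) i = insert (Ord i) (Ord ` {k. k < i \<and> fst (c k) \<le> k \<and> f (fst (c k)) = snd (c k)})"
| "edges Root i = Seq ` coh_tree i"

abbreviation "val \<equiv> unfold edges"

abbreviation "nodes \<equiv> Ord ` {..<w} \<union> range Seq \<union> {Root}"

lemma countable_below: "i < w \<Longrightarrow> countable {..<i}"
  using omega1 by (simp add: is_omega1_def)

lemmas osuc = omega1_osuc[OF omega1]

lemma countable_edges:
  assumes "d \<in> nodes" "i < w"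
  shows "countable (edges d i)"
proof (cases d)
  case (Seq f)
  have "countable {k. k < i \<and> fst (c k) \<le> k \<and> f (fst (c k)) = snd (c k)}"
    by (rule countable_subset[OF _ countable_below[OF assms(2)]]) auto
  with Seq show ?thesis by simp
qed (use assms countable_below countable_coh_tree in auto)

lemma elts_val: "d \<in> nodes \<Longrightarrow> i < w \<Longrightarrow> elts (val d (osuc i)) = (\<lambda>d. val d i) ` edges d i"
  using countable_edges osuc(1) by (intro elts_unfold_osuc)

section \<open>What each stage can distinguish\<close>

lemma val_Ord_eq_iff:
  assumes "i \<le> w" "k < w" "l < w"
  shows "val (Ord k) i = val (Ord l) i \<longleftrightarrow> k = l \<or> i \<le> k \<and> i \<le> l"
  using assms
proof (induction i arbitrary: k l rule: less_induct)
  case (less i)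
  have *: "val (Ord k) i \<noteq> val (Ord l) i" if "k < l" "k < i" "l < w" for k l
  proof (cases "is_limit i")
    case True
    have k: "k < w" using that by simp
    \<comment> \<open>Stage \<open>osuc k\<close> is the first to separate \<open>k\<close> from
      larger ordinals.\<close>
    have "osuc k < i"
      using True that(2) k osuc osuc_le unfolding is_limit_def by (metis order_le_less)
    moreover from this have "val (Ord k) (osuc k) \<noteq> val (Ord l) (osuc k)"
      using less.IH[of "osuc k" k l] less.prems(1) k that osuc(1)[OF k] by auto
    ultimately show ?thesis by (auto simp: unfold_limit True family_eq_iff)
  next
    case False
    then obtain i' where i': "i' < i" "i = osuc i'" by (metis not_limitE)
    have elts: "elts (val (Ord m) i) = (\<lambda>d. val d i') ` Ord ` {..<m}" if "m < w" for m
      using elts_val[of "Ord m" i'] that i' less.prems(1) by simp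
    have "k \<le> i'" using that i' osuc_le by (metis leD leI)
    have "val (Ord k) i' \<in> elts (val (Ord l) i)" using elts that by auto
    moreover have "val (Ord k) i' \<notin> elts (val (Ord k) i)"
    proof
      assume "val (Ord k) i' \<in> elts (val (Ord k) i)"
      then obtain m where "m < k" "val (Ord k) i' = val (Ord m) i'"
        using elts[of k] that less_trans[OF \<open>k < l\<close> \<open>l < w\<close>] by auto
      then show False
        using less.IH[OF i'(1), of k m] less.prems(1) i'(1) that \<open>k \<le> i'\<close> by auto
    qed
    ultimately show ?thesis by metis
  qed
  have **: "val (Ord k) i = val (Ord l) i" if "i \<le> k" "k < l" "l < w" for k l
  proof (cases "is_limit i")
    case True
    have "val (Ord k) j = val (Ord l) j" if "j < i" for j
      using less.IH[OF that, of k l] that less.prems(1) \<open>i \<le> k\<close> \<open>k < l\<close> \<open>l < w\<close> by auto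
    then show ?thesis by (simp add: unfold_limit True family_eq_iff)
  next
    case False
    then obtain i' where i': "i' < i" "i = osuc i'" by (metis not_limitE)
    \<comment> \<open>Members of \<open>l\<close> from \<open>k\<close> on look like
      \<open>i'\<close> at stage \<open>i'\<close>, and \<open>i'\<close> is itself a member of
      \<open>k\<close>.\<close>
    have "val (Ord m) i' \<in> (\<lambda>d. val d i') ` Ord ` {..<k}" if "m < l" for m
    proof (cases "m < k")
      case False
      then have "val (Ord m) i' = val (Ord i') i'"
        using less.IH[OF i'(1), of m i'] less.prems(1) i'(1) \<open>i \<le> k\<close> \<open>m < l\<close> \<open>l < w\<close> by auto
      moreover have "i' < k" using i'(1) \<open>i \<le> k\<close> by simp
      ultimately show ?thesis by auto
    qed auto
    then have "(\<lambda>d. val d i') ` Ord ` {..<k} = (\<lambda>d. val d i') ` Ord ` {..<l}"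
      using \<open>k < l\<close> by auto
    then show ?thesis using i' unfold_osuc[of i' edges] by simp
  qed
  show ?case
  proof (cases k l rule: linorder_cases)
    case less
    then show ?thesis using *[of k l] **[of k l] less.prems by (cases "k < i") auto
  next
    case greater
    then show ?thesis using *[of l k] **[of l k] less.prems by (cases "l < i") auto
  qed simp
qed

lemma val_Seq_cong:
  assumes "i \<le> w" "\<And>k. k < i \<Longrightarrow> f k = g k"
  shows "val (Seq f) i = val (Seq g) i"
  using assms
proof (induction i rule: less_induct)
  case (less i)
  show ?case
  proof (cases "is_limit i")
    case True
    have "val (Seq f) j = val (Seq g) j" if "j < i" for j
      using less that by auto
    then show ?thesis by (simp add: unfold_limit True family_eq_iff)
  next
    case False
    then obtain i' where i': "i' < i" "i = osuc i'" by (metis not_limitE)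
    have "f (fst (c k)) = g (fst (c k))" if "k < i'" "fst (c k) \<le> k" for k
      using less.prems(2) that i'(1) by (meson le_less_trans less_trans)
    then have "edges (Seq f) i' = edges (Seq g) i'" by auto
    then show ?thesis using i' unfold_osuc[of i' edges] by simp
  qed
qed

text \<open>Edges of \<open>Ord k\<close> do not vary. For \<open>Seq f\<close>, codes from
  \<open>j\<close> on collapse to \<open>Ord j\<close>, whose value the added edge supplies on both
  sides. For \<open>Root\<close>, levels are compared by restriction and extension.\<close>

lemma edges_coherent:
  assumes "d \<in> nodes" "j \<le> i" "i < w"
  shows "(\<lambda>d. val d j) ` edges d i = (\<lambda>d. val d j) ` edges d j"
proof (cases d)
  case (Seq f)
  let ?A = "\<lambda>i. {k. k < i \<and> fst (c k) \<le> k \<and> f (fst (c k)) = snd (c k)}"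
  let ?v = "\<lambda>k. val (Ord k) j"
  have top: "?v k = ?v j" if "j \<le> k" "k \<le> i" for k
    using val_Ord_eq_iff[of j k j] assms that by auto
  have "?v k \<in> insert (?v j) (?v ` ?A j)" if "k \<in> ?A i" for k
    using that top[of k] by (cases "k < j") auto
  then have "?v ` ?A i \<subseteq> insert (?v j) (?v ` ?A j)" by blast
  then have "insert (?v j) (?v ` ?A i) \<subseteq> insert (?v j) (?v ` ?A j)"
    by (simp only: insert_subset insertI1 simp_thms)
  moreover have "?v ` ?A j \<subseteq> ?v ` ?A i" using assms(2) by (intro image_mono) auto
  then have "insert (?v j) (?v ` ?A j) \<subseteq> insert (?v j) (?v ` ?A i)" by (rule insert_mono)
  ultimately have "insert (?v j) (?v ` ?A i) = insert (?v j) (?v ` ?A j)" by (rule subset_antisym)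
  moreover have "?v i = ?v j" using top[of i] assms(2) by simp
  ultimately show ?thesis by (simp add: Seq image_image)
next
  case Root
  have cnt: "\<And>j. j \<le> i \<Longrightarrow> countable {..<j}"
    using assms(3) countable_below by auto
  have jw: "j \<le> w" using assms(2,3) by simp
  have "val (Seq f) j \<in> (\<lambda>f. val (Seq f) j) ` coh_tree j" if "f \<in> coh_tree i" for f
  proof -
    have "val (Seq f) j = val (Seq (\<lambda>k. if k < j then f k else 0)) j"
      by (rule val_Seq_cong[OF jw]) simp
    then show ?thesis using coh_tree_restrict[OF cnt assms(2) that] by blast
  qed
  moreover have "val (Seq f) j \<in> (\<lambda>f. val (Seq f) j) ` coh_tree i" if "f \<in> coh_tree j" for f
  proof -
    have "val (Seq f) j = val (Seq (\<lambda>k. if k < j then f k else coh i k)) j"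
      by (rule val_Seq_cong[OF jw]) simp
    then show ?thesis using coh_tree_extend[OF cnt assms(2) that] by blast
  qed
  ultimately show ?thesis
    unfolding Root edges.simps image_image by blast
qed auto

lemma val_thread:
  assumes "d \<in> nodes" "i \<le> w"
  shows "val d i \<in> nu i" "k \<le> i \<Longrightarrow> conn i k (val d i) = val d k"
proof -
  have "edges d i \<subseteq> nodes" if "d \<in> nodes" "i < w" for d i
    using that by (cases d) auto
  from unfold_thread[OF countable_edges this edges_coherent assms(2,1)]
  show "val d i \<in> nu i" "k \<le> i \<Longrightarrow> conn i k (val d i) = val d k" by auto
qed

text \<open>For \<open>k < i\<close>, no other \<open>Ord l\<close> shares the value of
  \<open>Ord k\<close> at stage \<open>i\<close>, so not even the added edge \<open>Ord i\<close>
  can imitate the code \<open>k\<close>.\<close>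

lemma val_Seq_eqD:
  assumes "val (Seq f) (osuc i) = val (Seq g) (osuc i)"
    and "k < i" "i < w" "fst (c k) \<le> k" "f (fst (c k)) = snd (c k)"
  shows "g (fst (c k)) = snd (c k)"
proof -
  have elts: "elts (val (Seq h) (osuc i)) = (\<lambda>d. val d i) ` edges (Seq h) i" for h
    using assms(3) by (intro elts_val) auto
  have "Ord k \<in> edges (Seq f) i" using assms(2,4,5) by simp
  then have "val (Ord k) i \<in> (\<lambda>d. val d i) ` edges (Seq g) i"
    using elts[of f] elts[of g] assms(1) by (metis imageI)
  then obtain d where d: "d \<in> edges (Seq g) i" "val (Ord k) i = val d i"
    by blast
  from d(1) obtain l where l: "d = Ord l" "l \<le> i" by auto
  then have "l = k"
    using d(2) val_Ord_eq_iff[of i k l] assms(2,3) by auto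
  with d(1) l(1) assms(2) show ?thesis by auto
qed

section \<open>The root as the required element\<close>

lemma Root_nonzero: "val Root w \<noteq> zero_elt w"
proof
  assume eq: "val Root w = zero_elt w"
  obtain i where i: "i < w"
    using omega1 unfolding is_omega1_def by (metis countable_empty lessThan_iff subsetI subset_empty)
  have lim: "is_limit w" by (rule is_limit_omega1[OF omega1])
  have "val Root (osuc i) = zero_elt (osuc i)"
    using eq osuc(2)[OF i] by (simp add: unfold_limit lim zero_elt_limit family_eq_iff)
  then have "elts (val Root (osuc i)) = {}"
    using osuc(1)[OF i] by (simp add: zero_elt_osuc bot_cset.rep_eq)
  moreover have "elts (val Root (osuc i)) = (\<lambda>d. val d i) ` edges Root i"
    using i by (intro elts_val) auto
  ultimately show False using coh_in_coh_tree by auto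
qed

text \<open>
  A successor would decide, for each coded pair, whether it lies on the graph of a function on all
  countable ordinals whose restrictions are finite-to-one, which is impossible by the pigeonhole principle.
\<close>

lemma Root_no_successor:
  assumes b: "b \<in> nu w"
  shows "\<not> is_successor w (val Root w) b"
proof
  assume succ: "is_successor w (val Root w) b"
  have lim: "is_limit w" by (rule is_limit_omega1[OF omega1])
  have "\<exists>f\<in>coh_tree j. component b j = val (Seq f) j" if j: "j < w" for j
  proof -
    have "component b j \<in> elts (val Root (osuc j))"
      using succ j component_family[OF osuc(2)[OF j], of "val Root"]
      unfolding is_successor_def unfold_limit[OF lim] by metis
    moreover have "elts (val Root (osuc j)) = (\<lambda>d. val d j) ` edges Root j"
      using j by (intro elts_val) auto
    ultimately show ?thesis by auto
  qed
  then obtain f where f: "\<And>j. j < w \<Longrightarrow> f j \<in> coh_tree j"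
      "\<And>j. j < w \<Longrightarrow> component b j = val (Seq (f j)) j"
    by metis
  \<comment> \<open>The \<open>f j\<close> were chosen independently: only their values in the chain
    are known to be compatible.\<close>
  have comp: "val (Seq (f j)) k = val (Seq (f k)) k" if "k \<le> j" "j < w" for j k
  proof -
    have "conn j k (component b j) = component b k"
      using b that by (auto simp: nu_limit lim)
    then show ?thesis
      using val_thread(2)[of "Seq (f j)" j k] f(2) that by auto
  qed
  \<comment> \<open>Two successors are taken because \<open>val_Seq_eqD\<close> needs
    \<open>k < i\<close> and compares values at \<open>osuc i\<close>.\<close>
  define S where "S = {k. f (osuc (osuc k)) (fst (c k)) = snd (c k)}"
  have S: "k \<in> S \<longleftrightarrow> f j (fst (c k)) = snd (c k)"
    if "osuc (osuc k) \<le> j" "j < w" "k < w" "fst (c k) \<le> k" for j k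
  proof -
    have eq: "val (Seq (f j)) (osuc (osuc k)) = val (Seq (f (osuc (osuc k)))) (osuc (osuc k))"
      using comp[OF that(1,2)] .
    note k = osuc(1)[OF that(3)] osuc(2)[OF that(3)]
    show ?thesis
      unfolding S_def mem_Collect_eq
      using val_Seq_eqD[OF eq k that(4)] val_Seq_eqD[OF eq[symmetric] k that(4)] by blast
  qed
  obtain p where p: "\<And>i n. i < w \<Longrightarrow> i \<le> p i n \<and> p i n < w \<and> c (p i n) = (i, n)"
    using coding by metis
  have hit: "\<exists>n. p i n \<in> S" if i: "i < w" for i
  proof -
    have "osuc (osuc (p i n)) < w" for n using p[OF i] osuc(2) by blast
    \<comment> \<open>The bound must serve all \<open>n\<close> at once, since the relevant
      \<open>n = f j i\<close> depends on \<open>j\<close>.\<close>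
    then obtain j where j: "j < w" "\<And>n. osuc (osuc (p i n)) < j"
      using omega1_bounded[OF omega1, of UNIV "\<lambda>n. osuc (osuc (p i n))"] by auto
    have "p i (f j i) \<in> S"
      using S[of "p i (f j i)" j, OF less_imp_le[OF j(2)] j(1)] p[OF i, of "f j i"] by simp
    then show ?thesis ..
  qed
  have "\<exists>n. infinite {i. i < w \<and> p i n \<in> S}"
  proof (rule ccontr)
    assume "\<not> ?thesis"
    then have "countable {i. i < w \<and> p i n \<in> S}" for n by (intro countable_finite) blast
    then have "countable (\<Union>n. {i. i < w \<and> p i n \<in> S})" by (intro countable_UN countableI_type)
    moreover have "{..<w} \<subseteq> (\<Union>n. {i. i < w \<and> p i n \<in> S})" using hit by auto
    ultimately have "countable {..<w}" by (rule countable_subset[rotated])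
    then show False using omega1 by (simp add: is_omega1_def)
  qed
  then obtain n where "infinite {i. i < w \<and> p i n \<in> S}" ..
  \<comment> \<open>Countability of \<open>A\<close> bounds its codes below one \<open>j\<close>, so
    that the single function \<open>f j\<close> gets an infinite fibre.\<close>
  from infinite_countable_subset'[OF this]
  obtain A where A: "A \<subseteq> {i. i < w \<and> p i n \<in> S}" "countable A" "infinite A" by blast
  have "osuc (osuc (p i n)) < w" if "i \<in> A" for i using that A(1) p osuc(2) by blast
  then obtain j where j: "j < w" "\<And>i. i \<in> A \<Longrightarrow> osuc (osuc (p i n)) < j"
    using omega1_bounded[OF omega1 A(2), of "\<lambda>i. osuc (osuc (p i n))"] by auto
  have "A \<subseteq> {i. i < j \<and> f j i = n}"
  proof clarify
    fix i assume i: "i \<in> A"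
    then have iw: "i < w" "p i n \<in> S" using A(1) by auto
    from p[OF iw(1), of n] have p: "i \<le> p i n" "p i n < w" "c (p i n) = (i, n)" by auto
    have "p i n < osuc (p i n)" "osuc (p i n) < osuc (osuc (p i n))"
      using osuc[OF p(2)] osuc(1)[of "osuc (p i n)"] by auto
    then have "i < j" using p(1) j(2)[OF i] by order
    moreover have "f j i = n"
      using S[of "p i n" j, OF less_imp_le[OF j(2)[OF i]] j(1) p(2)] p iw(2) by simp
    ultimately show "i < j \<and> f j i = n" ..
  qed
  moreover have "finite {i. i < j \<and> f j i = n}"
    using countable_below f(1)[OF j(1)] j(1) by (intro coh_tree_finite_fibre) auto
  ultimately show False using A(3) finite_subset by blast
qed

end

theorem proposition6p1:
  fixes w1 :: "'o::wellorder"
  assumes "is_omega1 w1"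
  shows "\<exists>a \<in> nu w1. a \<noteq> zero_elt w1 \<and> \<not> (\<exists>b \<in> nu w1. is_successor w1 a b)"
proof -
  obtain c :: "'o \<Rightarrow> 'o \<times> nat" where "\<And>i n. i < w1 \<Longrightarrow> \<exists>k. i \<le> k \<and> k < w1 \<and> c k = (i, n)"
    using omega1_coding[OF assms] by blast
  then interpret omega1_coding w1 c
    using assms by unfold_locales
  show ?thesis
    using val_thread(1)[of Root w1] Root_nonzero Root_no_successor by auto
qed

end
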